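(* Let $G=(A\cup B,E)$ be a finite simple bipartite graph with $|A|=n_1$, $|B|=n_2$, $n_1\le n_2$. Let $\Delta_A=\max_{a\in A}d(a)$, $\Delta_B=\max_{b\in B}d(b)$ and $\Delta'=\min\{\Delta_A,\Delta_B\}$. Then $$\mathrm{cub}(G)\le 2(\Delta'+2)\lceil \ln n_2\rceil.$$
   Context: A $k$-cube is a product $R_1\times\cdots\times R_k$ of closed real intervals $R_i=[a_i,a_i+1]$. The cubicity $\mathrm{cub}(G)$ is the minimum $k$ such that $G$ is the intersection graph of a family of $k$-cubes (two vertices adjacent iff their cubes have nonempty intersection). $d(v)$ denotes the degree of $v$ in $G$.
   Formalization: The graph with n_1 = n_2 = 1 and no edges is excluded, because two isolated vertices have cubicity 1 while the bound is 0; cubicity 0 is allowed (complete graphs), and the maximum degree over an empty part is 0. *)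

theory Defs
  imports "HOL-Analysis.Analysis"
begin

definition finite_simple_graph :: "'a set \<Rightarrow> 'a set set \<Rightarrow> bool" where
  "finite_simple_graph V E \<longleftrightarrow> finite V \<and> (\<forall>e\<in>E. e \<subseteq> V \<and> card e = 2)"

definition finite_bipartite_graph :: "'a set \<Rightarrow> 'a set \<Rightarrow> 'a set set \<Rightarrow> bool" where
  "finite_bipartite_graph A B E \<longleftrightarrow>
     finite_simple_graph (A \<union> B) E \<and> A \<inter> B = {} \<and>
     (\<forall>e\<in>E. \<exists>a\<in>A. \<exists>b\<in>B. e = {a, b})"

definition degree :: "'a set set \<Rightarrow> 'a \<Rightarrow> nat" where
  "degree E v = card {e \<in> E. v \<in> e}"

(* The maximum over an empty set of vertices is taken to be 0. *)
definition max_degree_on :: "'a set set \<Rightarrow> 'a set \<Rightarrow> nat" where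
  "max_degree_on E S = Max (insert 0 (degree E ` S))"

(* Points of k-dimensional real space are the extensional functions on {..<k};
   in particular the only 0-cube is a single point. *)
definition is_cube :: "nat \<Rightarrow> (nat \<Rightarrow> real) set \<Rightarrow> bool" where
  "is_cube k R \<longleftrightarrow> (\<exists>a :: nat \<Rightarrow> real. R = (\<Pi>\<^sub>E i\<in>{..<k}. {a i..a i + 1}))"

definition cube_representation ::
    "nat \<Rightarrow> 'a set \<Rightarrow> 'a set set \<Rightarrow> ('a \<Rightarrow> (nat \<Rightarrow> real) set) \<Rightarrow> bool" where
  "cube_representation k V E R \<longleftrightarrow>
     (\<forall>v\<in>V. is_cube k (R v)) \<and>
     (\<forall>u\<in>V. \<forall>v\<in>V. u \<noteq> v \<longrightarrow> ({u, v} \<in> E \<longleftrightarrow> R u \<inter> R v \<noteq> {}))"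

(* The value k = 0 is allowed: complete graphs have cubicity 0. *)
definition cubicity :: "'a set \<Rightarrow> 'a set set \<Rightarrow> nat" where
  "cubicity V E = (LEAST k. \<exists>R. cube_representation k V E R)"

end

(*
  A graph has cubicity at most k iff there are k real-valued functions on its vertices such that the
  ends of every edge differ by at most 1 in each of them and the ends of every non-edge differ by
  more than 1 in one of them.  Let X, Y be the two sides, every y in Y having at most D
  neighbours N(y), and let m = ceiling (ln n2), so that n2 <= 4^m.

  An injection pi of X into (-1/2, 1/2) and signs s(y) give such a function: x is sent to pi(x), and y
  to s(y) * (1 + min {s(y) * pi(z) | z in N(y)}), the minimum being capped at 1/2.  It separates
  vertices of Y with different signs, and it separates x from y iff s(y) * pi(x) lies strictly
  below the minimum.  For a random injection that happens with probability at least 1/(D+1),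
  whatever the sign, so 2(D+1)m functions suffice for all non-adjacent pairs (x, y).  Taking the
  signs from a binary code of Y, they separate the pairs in Y too.  The pairs in X are
  separated by 2m further functions that put Y at 0 and X at -1 or 1 according to a binary code.
*)
theory Submission
  imports Defs
begin

section \<open>Cubicity from real-valued functions\<close>

text \<open>The number \<open>f i v\<close> serves as the left end of side \<open>i\<close> of the
  cube of \<open>v\<close>. Boxes meet iff their sides meet in every coordinate, and closed unit
  intervals meet iff their left ends differ by at most 1.\<close>

lemma cubicity_le:
  fixes f :: "nat \<Rightarrow> 'a \<Rightarrow> real"
  assumes edge: "\<And>u v i. u \<in> V \<Longrightarrow> v \<in> V \<Longrightarrow> u \<noteq> v \<Longrightarrow> {u, v} \<in> E \<Longrightarrow> i < k \<Longrightarrow> \<bar>f i u - f i v\<bar> \<le> 1"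
    and nonedge: "\<And>u v. u \<in> V \<Longrightarrow> v \<in> V \<Longrightarrow> u \<noteq> v \<Longrightarrow> {u, v} \<notin> E \<Longrightarrow> \<exists>i<k. \<bar>f i u - f i v\<bar> > 1"
  shows "cubicity V E \<le> k"
proof -
  define R where "R v = (\<Pi>\<^sub>E i\<in>{..<k}. {f i v..f i v + 1})" for v
  have "R u \<inter> R v \<noteq> {} \<longleftrightarrow> (\<forall>i<k. \<bar>f i u - f i v\<bar> \<le> 1)" for u v
  proof -
    have "R u \<inter> R v \<noteq> {} \<longleftrightarrow> (\<forall>i<k. {f i u..f i u + 1} \<inter> {f i v..f i v + 1} \<noteq> {})"
      unfolding R_def PiE_Int PiE_eq_empty_iff by blast
    also have "\<dots> \<longleftrightarrow> (\<forall>i<k. \<bar>f i u - f i v\<bar> \<le> 1)"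
      by (intro all_cong1 imp_cong refl) auto
    finally show ?thesis .
  qed
  then have "{u, v} \<in> E \<longleftrightarrow> R u \<inter> R v \<noteq> {}" if "u \<in> V" "v \<in> V" "u \<noteq> v" for u v
    using edge[OF that] nonedge[OF that] by (meson not_le)
  moreover have "is_cube k (R v)" for v
    unfolding is_cube_def R_def by (rule exI[of _ "\<lambda>i. f i v"]) (rule refl)
  ultimately have "cube_representation k V E R"
    unfolding cube_representation_def by blast
  then show ?thesis
    unfolding cubicity_def by (blast intro: Least_le)
qed

section \<open>Greedy covering by averaging\<close>

lemma card_filter_real:
  assumes "finite U"
  shows "real (card {p \<in> U. Q p}) = (\<Sum>p\<in>U. of_bool (Q p))"
  using assms by (simp add: Int_def)

text \<open>Each \<open>p\<close> is missed by at most \<open>(1 - q) * card S\<close> members of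
  \<open>S\<close>. Counting the missed pairs in two ways shows that not every \<open>s\<close> can
  miss more than \<open>(1 - q) * card U\<close> points.\<close>

lemma exists_covering_step:
  fixes q :: real
  assumes "finite S" "S \<noteq> {}" "finite U"
    and q: "\<And>p. p \<in> U \<Longrightarrow> q * card S \<le> card {s \<in> S. cov s p}"
  shows "\<exists>s\<in>S. real (card {p \<in> U. \<not> cov s p}) \<le> (1 - q) * card U"
proof (rule ccontr)
  assume "\<not> ?thesis"
  then have "(\<Sum>s\<in>S. (1 - q) * card U) < (\<Sum>s\<in>S. real (card {p \<in> U. \<not> cov s p}))"
    using assms by (intro sum_strict_mono) (auto simp: not_le)
  also have "\<dots> = (\<Sum>p\<in>U. real (card {s \<in> S. \<not> cov s p}))"
    using assms(1,3) by (simp only: card_filter_real) (rule sum.swap)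
  also have "\<dots> \<le> (\<Sum>p\<in>U. (1 - q) * card S)"
  proof (rule sum_mono)
    fix p assume "p \<in> U"
    have "card S = card ({s \<in> S. cov s p} \<union> {s \<in> S. \<not> cov s p})"
      by (rule arg_cong[where f = card]) auto
    also have "\<dots> = card {s \<in> S. cov s p} + card {s \<in> S. \<not> cov s p}"
      using assms(1) by (intro card_Un_disjoint) auto
    finally show "real (card {s \<in> S. \<not> cov s p}) \<le> (1 - q) * card S"
      using q[OF \<open>p \<in> U\<close>] by (simp add: algebra_simps)
  qed
  finally show False by (simp add: algebra_simps)
qed

text \<open>Greedy choice replaces independent random choices: each new element is picked against
  the points still uncovered and leaves at most a fraction \<open>1 - q\<close> of them. The
  relation \<open>cov\<close> depends on \<open>i\<close> because the signs of the vertices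
  will.\<close>

lemma exists_covering_sequence:
  fixes q :: real
  assumes "finite S" "S \<noteq> {}" "finite P" "q \<le> 1"
    and q: "\<And>i p. p \<in> P \<Longrightarrow> q * card S \<le> card {s \<in> S. cov i s p}"
  shows "\<exists>t. (\<forall>i<k. t i \<in> S) \<and>
    real (card {p \<in> P. \<forall>i<k. \<not> cov i (t i) p}) \<le> (1 - q) ^ k * card P"
proof (induction k)
  case 0
  then show ?case by simp
next
  case (Suc k)
  then obtain t where t: "\<forall>i<k. t i \<in> S"
    "real (card {p \<in> P. \<forall>i<k. \<not> cov i (t i) p}) \<le> (1 - q) ^ k * card P" by blast
  define U where "U = {p \<in> P. \<forall>i<k. \<not> cov i (t i) p}"
  have "\<exists>s\<in>S. real (card {p \<in> U. \<not> cov k s p}) \<le> (1 - q) * card U"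
    using assms by (intro exists_covering_step) (auto simp: U_def)
  then obtain s where s: "s \<in> S" "real (card {p \<in> U. \<not> cov k s p}) \<le> (1 - q) * card U"
    by blast
  have eq: "{p \<in> P. \<forall>i<Suc k. \<not> cov i ((t(k := s)) i) p} = {p \<in> U. \<not> cov k s p}"
    by (auto simp: U_def less_Suc_eq)
  have "(1 - q) * card U \<le> (1 - q) ^ Suc k * card P"
    using t(2) \<open>q \<le> 1\<close> mult_left_mono[of "real (card U)" "(1 - q) ^ k * card P" "1 - q"]
    by (simp add: U_def mult.assoc)
  then show ?case
    using s t(1) eq by (intro exI[of _ "t(k := s)"]) (auto simp: less_Suc_eq)
qed

section \<open>Uniformly random injections\<close>

text \<open>Extensionality makes the set finite for finite \<open>X\<close> and \<open>W\<close>, so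
  probabilities become quotients of cardinalities.\<close>

definition injections :: "'a set \<Rightarrow> 'b set \<Rightarrow> ('a \<Rightarrow> 'b) set" where
  "injections X W = {f \<in> X \<rightarrow>\<^sub>E W. inj_on f X}"

lemma finite_injections: "finite X \<Longrightarrow> finite W \<Longrightarrow> finite (injections X W)"
  by (simp add: injections_def finite_PiE)

lemma injections_nonempty:
  assumes "finite X" "finite W" "card X \<le> card W"
  shows "injections X W \<noteq> {}"
proof -
  obtain f where "f ` X \<subseteq> W" "inj_on f X"
    using assms by (metis card_le_inj)
  then have "restrict f X \<in> injections X W"
    by (auto simp: injections_def)
  then show ?thesis by blast
qed

lemma injections_transpose:
  assumes "f \<in> injections X W" "x \<in> X" "t \<in> X"
  shows "f \<circ> Transposition.transpose x t \<in> injections X W"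
proof -
  have "Transposition.transpose x t ` X = X"
    using assms by (auto simp: transpose_image_eq)
  then show ?thesis
    using assms unfolding injections_def
    by (auto simp: PiE_iff extensional_def Transposition.transpose_def intro!: comp_inj_on)
qed

text \<open>Swapping \<open>x\<close> with another point of \<open>insert x N\<close> shows that each of these points is equally
  often the one with the smallest key.\<close>
lemma card_injections_first:
  fixes key :: "'b \<Rightarrow> real"
  assumes "finite X" "finite W" and key: "inj_on key W"
    and x: "x \<in> X" and N: "N \<subseteq> X" "x \<notin> N" "card N \<le> D"
  shows "card (injections X W) \<le> (D + 1) * card {f \<in> injections X W. \<forall>y\<in>N. key (f x) < key (f y)}"
proof -
  define T where "T = insert x N"
  define M where "M t = {f \<in> injections X W. \<forall>s\<in>T - {t}. key (f t) < key (f s)}" for t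
  have finN: "finite N" using N(1) \<open>finite X\<close> finite_subset by blast
  have T: "finite T" "T \<noteq> {}" "T \<subseteq> X" "card T \<le> D + 1"
    using x N finN by (auto simp: T_def)
  have fin: "finite (M t)" for t
    using finite_injections[OF assms(1,2)] by (simp add: M_def)
  \<comment> \<open>Since \<open>key\<close> is injective on \<open>W\<close> and \<open>f\<close>
    on \<open>X\<close>, the least key over \<open>T\<close> is attained at one point only, so the
    strict inequalities in \<open>M\<close> hold there.\<close>
  have "injections X W \<subseteq> (\<Union>t\<in>T. M t)"
  proof
    fix f assume f: "f \<in> injections X W"
    obtain t where t: "t \<in> T" "\<And>s. s \<in> T \<Longrightarrow> key (f t) \<le> key (f s)"
      using ex_min_if_finite[of "(\<lambda>t. key (f t)) ` T"] T by (auto simp: not_less)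
    have "key (f t) \<noteq> key (f s)" if "s \<in> T - {t}" for s
    proof
      assume "key (f t) = key (f s)"
      moreover have "f t \<in> W" "f s \<in> W" using f t that T by (auto simp: injections_def)
      ultimately have "f t = f s" using key by (auto dest: inj_onD)
      then show False using f t that T by (auto simp: injections_def dest: inj_onD)
    qed
    then have "f \<in> M t" using t f by (auto simp: M_def less_le)
    then show "f \<in> (\<Union>t\<in>T. M t)" using t by blast
  qed
  then have "card (injections X W) \<le> card (\<Union>t\<in>T. M t)"
    using T fin by (intro card_mono) auto
  also have "\<dots> \<le> (\<Sum>t\<in>T. card (M t))"
    using T by (intro card_UN_le)
  also have "\<dots> \<le> (\<Sum>t\<in>T. card (M x))"
  proof (rule sum_mono)
    fix t assume t: "t \<in> T"
    let ?\<tau> = "Transposition.transpose x t"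
    have "(\<lambda>f. f \<circ> ?\<tau>) ` M t \<subseteq> M x"
    proof safe
      fix f assume f: "f \<in> M t"
      have "key (f t) < key (f (?\<tau> s))" if "s \<in> T - {x}" for s
      proof -
        have "?\<tau> s \<in> T - {t}" using that t by (auto simp: Transposition.transpose_def T_def)
        then show ?thesis using f by (auto simp: M_def)
      qed
      moreover have "f \<circ> ?\<tau> \<in> injections X W"
        using f t T x by (intro injections_transpose) (auto simp: M_def)
      ultimately show "f \<circ> ?\<tau> \<in> M x" by (auto simp: M_def)
    qed
    moreover have "inj (\<lambda>f :: 'a \<Rightarrow> 'b. f \<circ> ?\<tau>)"
      by (rule injI) (metis comp_assoc transpose_comp_involutory comp_id)
    ultimately show "card (M t) \<le> card (M x)"
      using fin by (meson card_inj_on_le inj_on_subset subset_UNIV)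
  qed
  also have "\<dots> \<le> (D + 1) * card (M x)"
    using T(4) by (simp only: sum_constant of_nat_id mult_le_mono1)
  also have "M x = {f \<in> injections X W. \<forall>y\<in>N. key (f x) < key (f y)}"
    using N by (auto simp: M_def T_def)
  finally show ?thesis .
qed

section \<open>Binary codes and logarithmic estimates\<close>

lemma exists_binary_code:
  assumes "finite X" "card X \<le> 2 ^ K"
  shows "\<exists>c :: 'a \<Rightarrow> nat set. \<forall>x\<in>X. \<forall>x'\<in>X. x \<noteq> x' \<longrightarrow> (\<exists>i<K. i \<in> c x \<longleftrightarrow> i \<notin> c x')"
proof -
  obtain c :: "'a \<Rightarrow> nat set" where c: "c ` X \<subseteq> Pow {..<K}" "inj_on c X"
    using card_le_inj[of X "Pow {..<K}"] assms by (auto simp: card_Pow)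
  have "\<exists>i<K. i \<in> c x \<longleftrightarrow> i \<notin> c x'" if "x \<in> X" "x' \<in> X" "x \<noteq> x'" for x x'
  proof -
    have "c x \<noteq> c x'" using c that by (auto dest: inj_onD)
    then show ?thesis using c that by (auto simp: image_subset_iff Pow_iff subset_iff)
  qed
  then show ?thesis by blast
qed

text \<open>As e is at most 3, n is at most e^m and hence at most 4^m, so \<open>2 * m\<close> bits
  distinguish n vertices. The assumption n >= 2 makes the logarithm positive.\<close>

lemma ceiling_ln_bounds:
  fixes n :: nat
  assumes "n \<ge> 2"
  defines "m \<equiv> nat \<lceil>ln (real n)\<rceil>"
  shows "m > 0" "n \<le> 2 ^ (2 * m)" "real n \<le> exp m"
proof -
  have pos: "ln (real n) > 0" using assms by simp
  then show "m > 0" by (simp add: m_def)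
  have "ln (real n) \<le> m" unfolding m_def using pos by linarith
  then show le: "real n \<le> exp m"
    using assms by (metis exp_le_cancel_iff exp_ln of_nat_0_less_iff zero_less_numeral order_less_le_trans)
  also have "exp (real m) = exp 1 ^ m" by (simp flip: exp_of_nat_mult)
  also have "\<dots> \<le> (2 ^ 2) ^ m"
    using exp_le by (intro power_mono) auto
  finally have "real n \<le> real ((2 ^ 2) ^ m)" by simp
  then show "n \<le> 2 ^ (2 * m)"
    unfolding of_nat_le_iff power_mult .
qed

text \<open>With q = 1/(D+1), the strict bound 1 - q < exp(-q) makes the power smaller than
  exp(-2m), while c is at most n^2 and so at most exp(2m). The case c = 0 is apart because
  multiplying by it loses strictness.\<close>

lemma covering_estimate:
  fixes D m n c :: nat
  assumes "n > 0" "m > 0" "real n \<le> exp m" "c \<le> n\<^sup>2"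
  shows "(1 - 1 / real (D + 1)) ^ (2 * (D + 1) * m) * real c < 1"
proof -
  let ?q = "1 / real (D + 1)"
  have "(1 - ?q) ^ (2 * (D + 1) * m) < exp (- ?q) ^ (2 * (D + 1) * m)"
    using assms by (intro power_strict_mono) (auto simp: exp_minus_greater)
  also have "\<dots> = exp (- (2 * real m))"
    by (simp add: field_simps flip: exp_of_nat_mult)
  finally have *: "(1 - ?q) ^ (2 * (D + 1) * m) < exp (- (2 * real m))" .
  have "real c \<le> (real n)\<^sup>2" using assms(4) by (metis of_nat_le_iff of_nat_power)
  also have "\<dots> \<le> exp m ^ 2" using assms by (intro power_mono) auto
  also have "\<dots> = exp (2 * real m)" by (simp flip: exp_of_nat_mult)
  finally have c: "real c \<le> exp (2 * real m)" .
  show ?thesis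
  proof (cases "c = 0")
    case False
    then have "(1 - ?q) ^ (2 * (D + 1) * m) * real c < exp (- (2 * real m)) * real c"
      using * by (intro mult_strict_right_mono) auto
    also have "\<dots> \<le> exp (- (2 * real m)) * exp (2 * real m)"
      using c by (intro mult_left_mono) auto
    finally show ?thesis by (simp flip: exp_add)
  qed simp
qed

section \<open>Separating the non-adjacent pairs across the two sides\<close>

text \<open>The greedy covering is applied to the pairs in \<open>P\<close>, of which there are at
  most n^2. The signs are given beforehand and arbitrary, which later allows taking them from a
  code.\<close>

lemma exists_separating_injections:
  fixes N :: "'a \<Rightarrow> 'a set" and \<sigma> :: "nat \<Rightarrow> 'a \<Rightarrow> real"
  assumes fin: "finite X" "finite Y" and n: "n \<ge> 2" "card X \<le> n" "card Y \<le> n"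
    and N: "\<And>y. y \<in> Y \<Longrightarrow> N y \<subseteq> X" "\<And>y. y \<in> Y \<Longrightarrow> card (N y) \<le> D"
    and \<sigma>: "\<And>i y. \<sigma> i y \<noteq> 0"
  shows "\<exists>\<pi>. (\<forall>i < 2 * (D + 1) * nat \<lceil>ln (real n)\<rceil>. \<forall>x\<in>X. \<bar>\<pi> i x\<bar> < 1 / 2) \<and>
    (\<forall>x\<in>X. \<forall>y\<in>Y. x \<notin> N y \<longrightarrow> (\<exists>i < 2 * (D + 1) * nat \<lceil>ln (real n)\<rceil>. \<forall>z\<in>N y. \<sigma> i y * \<pi> i x < \<sigma> i y * \<pi> i z))"
proof -
  define m where "m = nat \<lceil>ln (real n)\<rceil>"
  define k where "k = 2 * (D + 1) * m"
  obtain W :: "real set" where W: "W \<subseteq> {- (1/2)<..<1/2}" "finite W" "card W = card X"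
    using infinite_arbitrarily_large[of "{- (1/2)<..<1/2 :: real}"] by auto
  define P where "P = {(x, y) \<in> X \<times> Y. x \<notin> N y}"
  define cov where "cov i s p = (\<forall>z\<in>N (snd p). \<sigma> i (snd p) * s (fst p) < \<sigma> i (snd p) * s z)"
    for i and s :: "'a \<Rightarrow> real" and p :: "'a \<times> 'a"
  have "\<exists>\<pi>. (\<forall>i<k. \<pi> i \<in> injections X W) \<and>
    real (card {p \<in> P. \<forall>i<k. \<not> cov i (\<pi> i) p}) \<le> (1 - 1 / real (D + 1)) ^ k * card P"
  proof (rule exists_covering_sequence)
    show "finite (injections X W)" "injections X W \<noteq> {}"
      using fin W by (simp_all add: finite_injections injections_nonempty)
    show "finite P" using fin by (auto simp: P_def intro: finite_subset[of _ "X \<times> Y"])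
    fix i p assume p: "p \<in> P"
    \<comment> \<open>Multiplication by a nonzero sign is an injective key, so either sign gives the
      same chance of at least 1/(D+1).\<close>
    have "card (injections X W) \<le> (D + 1) * card {s \<in> injections X W. cov i s p}"
      unfolding cov_def
      using card_injections_first[of X W "\<lambda>r. \<sigma> i (snd p) * r" "fst p" "N (snd p)" D]
        fin W N p \<sigma> by (auto simp: P_def inj_on_def)
    then have "real (card (injections X W)) \<le> real (D + 1) * card {s \<in> injections X W. cov i s p}"
      by (metis of_nat_le_iff of_nat_mult)
    then show "1 / real (D + 1) * card (injections X W) \<le> card {s \<in> injections X W. cov i s p}"
      by (simp add: field_simps)
  qed simp
  then obtain \<pi> where \<pi>: "\<And>i. i < k \<Longrightarrow> \<pi> i \<in> injections X W"
    "real (card {p \<in> P. \<forall>i<k. \<not> cov i (\<pi> i) p}) \<le> (1 - 1 / real (D + 1)) ^ k * card P"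
    by blast
  have P: "finite P" "card P \<le> n\<^sup>2"
  proof -
    have sub: "P \<subseteq> X \<times> Y" by (auto simp: P_def)
    then show "finite P" using fin finite_subset by blast
    have "card P \<le> card X * card Y" using sub fin by (metis card_cartesian_product card_mono finite_cartesian_product)
    also have "\<dots> \<le> n\<^sup>2" using n by (simp add: power2_eq_square mult_le_mono)
    finally show "card P \<le> n\<^sup>2" .
  qed
  have "(1 - 1 / real (D + 1)) ^ k * card P < 1"
    unfolding k_def using n P ceiling_ln_bounds[OF n(1)]
    by (intro covering_estimate[of n]) (auto simp: m_def)
  \<comment> \<open>A natural number below 1 is 0, so no pair remains uncovered.\<close>
  then have "card {p \<in> P. \<forall>i<k. \<not> cov i (\<pi> i) p} = 0" using \<pi>(2) by linarith
  then have all: "\<exists>i<k. cov i (\<pi> i) p" if "p \<in> P" for p using that P(1) by (cases p) auto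
  have "\<exists>i<k. \<forall>z\<in>N y. \<sigma> i y * \<pi> i x < \<sigma> i y * \<pi> i z" if "x \<in> X" "y \<in> Y" "x \<notin> N y" for x y
    using all[of "(x, y)"] that by (auto simp: P_def cov_def)
  moreover have "\<bar>\<pi> i x\<bar> < 1 / 2" if "i < k" "x \<in> X" for i x
  proof -
    have "\<pi> i x \<in> W" using \<pi>(1)[OF that(1)] that(2) by (auto simp: injections_def)
    then have "\<pi> i x \<in> {- (1/2)<..<1/2}" using W(1) by blast
    then show ?thesis unfolding greaterThanLessThan_iff by linarith
  qed
  ultimately show ?thesis unfolding m_def[symmetric] k_def[symmetric] by blast
qed

section \<open>The coordinate functions for a bipartite graph\<close>

text \<open>Only degrees on the side \<open>Y\<close> enter, so either side may play that role. The
  count is 2(D+1)m functions from injections plus 2m from a code of \<open>X\<close>.\<close>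

lemma cubicity_bipartite_le:
  assumes fin: "finite X" "finite Y" and disj: "X \<inter> Y = {}"
    and n: "n \<ge> 2" "card X \<le> n" "card Y \<le> n"
    and E: "\<And>e. e \<in> E \<Longrightarrow> \<exists>x\<in>X. \<exists>y\<in>Y. e = {x, y}"
    and D: "\<And>y. y \<in> Y \<Longrightarrow> degree E y \<le> D"
  shows "cubicity (X \<union> Y) E \<le> 2 * (D + 2) * nat \<lceil>ln (real n)\<rceil>"
proof -
  define m where "m = nat \<lceil>ln (real n)\<rceil>"
  define k where "k = 2 * (D + 1) * m"
  have m: "m > 0" "n \<le> 2 ^ (2 * m)" using ceiling_ln_bounds[OF n(1)] by (simp_all add: m_def)
  define N where "N y = {x \<in> X. {x, y} \<in> E}" for y
  have finN: "finite (N y)" for y using fin by (simp add: N_def)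
  have cardN: "card (N y) \<le> D" if "y \<in> Y" for y
  proof -
    have "finite E" by (rule finite_subset[of _ "Pow (X \<union> Y)"]) (use E fin in auto)
    have "inj_on (\<lambda>x. {x, y}) (N y)" by (auto simp: inj_on_def doubleton_eq_iff)
    then have "card (N y) \<le> degree E y"
      unfolding degree_def by (rule card_inj_on_le) (use \<open>finite E\<close> in \<open>auto simp: N_def\<close>)
    then show ?thesis using D[OF that] by simp
  qed
  obtain cX :: "'a \<Rightarrow> nat set" where
    cX: "\<And>x x'. x \<in> X \<Longrightarrow> x' \<in> X \<Longrightarrow> x \<noteq> x' \<Longrightarrow> \<exists>i<2*m. i \<in> cX x \<longleftrightarrow> i \<notin> cX x'"
    using exists_binary_code[of X "2 * m"] fin n m by (meson order_trans)
  obtain cY :: "'a \<Rightarrow> nat set" where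
    cY: "\<And>y y'. y \<in> Y \<Longrightarrow> y' \<in> Y \<Longrightarrow> y \<noteq> y' \<Longrightarrow> \<exists>i<2*m. i \<in> cY y \<longleftrightarrow> i \<notin> cY y'"
    using exists_binary_code[of Y "2 * m"] fin n m by (meson order_trans)
  \<comment> \<open>The first \<open>2 * m\<close> signs separate \<open>Y\<close>; for larger
    \<open>i\<close> any signs would do.\<close>
  define \<sigma> :: "nat \<Rightarrow> 'a \<Rightarrow> real" where "\<sigma> i y = (if i \<in> cY y then 1 else - 1)" for i y
  have \<sigma>: "\<sigma> i y = 1 \<or> \<sigma> i y = - 1" for i y by (simp add: \<sigma>_def)
  have \<sigma>0: "\<sigma> i y \<noteq> 0" for i y by (simp add: \<sigma>_def)
  obtain \<pi> where \<pi>: "\<And>i x. i < k \<Longrightarrow> x \<in> X \<Longrightarrow> \<bar>\<pi> i x\<bar> < 1 / 2"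
    and sep: "\<And>x y. x \<in> X \<Longrightarrow> y \<in> Y \<Longrightarrow> x \<notin> N y \<Longrightarrow> \<exists>i<k. \<forall>z\<in>N y. \<sigma> i y * \<pi> i x < \<sigma> i y * \<pi> i z"
  proof -
    have "N y \<subseteq> X" for y by (auto simp: N_def)
    from exists_separating_injections[where N = N and \<sigma> = \<sigma>, OF fin n this cardN \<sigma>0] show ?thesis
      using that unfolding k_def m_def by blast
  qed
  \<comment> \<open>The cap 1/2 gives a value when \<open>N y\<close> is empty and, for
    \<open>i < k\<close>, exceeds every signed value of \<pi> on \<open>X\<close>, so it never
    prevents a separation.\<close>
  define \<mu> where "\<mu> i y = Min (insert (1 / 2) ((\<lambda>z. \<sigma> i y * \<pi> i z) ` N y))" for i y
  have \<mu>_le: "\<mu> i y \<le> \<sigma> i y * \<pi> i z" if "z \<in> N y" for i y z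
    unfolding \<mu>_def using that finN by (intro Min_le) auto
  have \<sigma>\<pi>: "\<bar>\<sigma> i y * \<pi> i x\<bar> < 1 / 2" if "i < k" "x \<in> X" for i x y
    using \<pi>[OF that] \<sigma>[of i y] by (auto simp: abs_mult)
  have less_\<mu>: "r < \<mu> i y" if "r < 1 / 2" "\<And>z. z \<in> N y \<Longrightarrow> r < \<sigma> i y * \<pi> i z" for r i y
    unfolding \<mu>_def using that finN by (subst Min_gr_iff) auto
  have \<mu>_gt: "\<mu> i y > - (1 / 2)" if "i < k" for i y
  proof (rule less_\<mu>)
    fix z assume "z \<in> N y"
    then have "z \<in> X" by (simp add: N_def)
    then show "- (1 / 2) < \<sigma> i y * \<pi> i z" using \<sigma>\<pi>[OF that, of z y] by linarith
  qed simp
  define f where "f i v =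
    (if i < k then if v \<in> X then \<pi> i v else \<sigma> i v * (1 + \<mu> i v)
     else if v \<in> X then if i - k \<in> cX v then 1 else - 1 else 0)" for i v
  \<comment> \<open>Multiplying the difference by the sign, which is 1 or -1, keeps its absolute
    value and treats both signs at once.\<close>
  have cross: "\<bar>f i x - f i y\<bar> = \<bar>1 + \<mu> i y - \<sigma> i y * \<pi> i x\<bar>" if "i < k" "x \<in> X" "y \<in> Y" for i x y
    using that \<sigma>[of i y] disj by (auto simp: f_def)
  have edge: "\<bar>f i x - f i y\<bar> \<le> 1" if "x \<in> X" "y \<in> Y" "{x, y} \<in> E" for x y i
  proof (cases "i < k")
    case True
    have "x \<in> N y" using that by (simp add: N_def)
    \<comment> \<open>The quantity in \<open>cross\<close> is at most 1 because \<mu> is a lower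
      bound over \<open>N y\<close>, and positive because \<mu> > -1/2 and the signed value of \<pi>
      is below 1/2.\<close>
    then show ?thesis
      using \<mu>_le[of x y i] \<mu>_gt[OF True, of y] \<sigma>\<pi>[OF True, of x y] that cross[OF True, of x y] by auto
  next
    case False
    then show ?thesis using that disj by (auto simp: f_def)
  qed
  have nonedge: "\<exists>i<k + 2 * m. \<bar>f i x - f i y\<bar> > 1" if "x \<in> X" "y \<in> Y" "{x, y} \<notin> E" for x y
  proof -
    have "x \<notin> N y" using that by (simp add: N_def)
    from sep[OF that(1,2) this] obtain i where i: "i < k" "\<And>z. z \<in> N y \<Longrightarrow> \<sigma> i y * \<pi> i x < \<sigma> i y * \<pi> i z"
      by blast
    then have "\<sigma> i y * \<pi> i x < \<mu> i y"
      using \<sigma>\<pi>[of i x y] that by (intro less_\<mu>) auto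
    then show ?thesis using cross[of i x y] i that by (intro exI[of _ i]) auto
  qed
  have nonedge_X: "\<exists>i<k + 2 * m. \<bar>f i x - f i x'\<bar> > 1" if "x \<in> X" "x' \<in> X" "x \<noteq> x'" for x x'
  proof -
    from cX[OF that] obtain i where "i < 2 * m" "i \<in> cX x \<longleftrightarrow> i \<notin> cX x'" by blast
    then show ?thesis using that by (intro exI[of _ "k + i"]) (auto simp: f_def)
  qed
  have nonedge_Y: "\<exists>i<k + 2 * m. \<bar>f i y - f i y'\<bar> > 1" if "y \<in> Y" "y' \<in> Y" "y \<noteq> y'" for y y'
  proof -
    from cY[OF that] obtain i where i: "i < 2 * m" "i \<in> cY y \<longleftrightarrow> i \<notin> cY y'" by blast
    \<comment> \<open>The \<open>2 * m\<close> code positions fit among the first \<open>k\<close>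
      coordinates. There both vertices have absolute value above 1/2, so opposite signs put them
      more than 1 apart.\<close>
    have "i < k" using i(1) by (simp add: k_def)
    then show ?thesis
      using that disj i \<mu>_gt[of i y] \<mu>_gt[of i y'] by (intro exI[of _ i]) (auto simp: f_def \<sigma>_def)
  qed
  have "cubicity (X \<union> Y) E \<le> k + 2 * m"
  proof (rule cubicity_le)
    fix u v i assume "{u, v} \<in> E"
    then obtain x y where "x \<in> X" "y \<in> Y" "{u, v} = {x, y}" using E by blast
    then show "\<bar>f i u - f i v\<bar> \<le> 1"
      using edge[of x y i] \<open>{u, v} \<in> E\<close> by (auto simp: doubleton_eq_iff abs_minus_commute insert_commute)
  next
    fix u v assume uv: "u \<in> X \<union> Y" "v \<in> X \<union> Y" "u \<noteq> v" "{u, v} \<notin> E"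
    then consider "u \<in> X" "v \<in> X" | "u \<in> Y" "v \<in> Y" | "u \<in> X" "v \<in> Y" | "v \<in> X" "u \<in> Y" by blast
    then show "\<exists>i<k + 2 * m. \<bar>f i u - f i v\<bar> > 1"
    proof cases
      case 4
      then show ?thesis using nonedge[of v u] uv by (simp add: insert_commute abs_minus_commute)
    qed (use uv nonedge_X nonedge_Y nonedge in blast)+
  qed
  also have "k + 2 * m = 2 * (D + 2) * m" by (simp add: k_def algebra_simps)
  finally show ?thesis by (simp add: m_def)
qed

section \<open>Choice of the side, and the case of at most one vertex per side\<close>

lemma degree_le_max_degree_on: "finite S \<Longrightarrow> v \<in> S \<Longrightarrow> degree E v \<le> max_degree_on E S"
  unfolding max_degree_on_def by (intro Max_ge) auto

text \<open>The bipartite bound is used with both orders of the sides, and the smaller result is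
  kept. Two isolated vertices, one on each side, are excluded: their cubicity is 1, but the
  right-hand side is 0.\<close>

theorem theorem3p1:
  fixes A B :: "'a set" and E :: "'a set set"
    and n\<^sub>1 n\<^sub>2 \<Delta>\<^sub>A \<Delta>\<^sub>B \<Delta>' :: nat
  assumes "finite_bipartite_graph A B E"
    and "card A = n\<^sub>1" and "card B = n\<^sub>2" and "n\<^sub>1 \<le> n\<^sub>2"
    and "\<Delta>\<^sub>A = max_degree_on E A" and "\<Delta>\<^sub>B = max_degree_on E B"
    and "\<Delta>' = min \<Delta>\<^sub>A \<Delta>\<^sub>B"
    and "\<not> (n\<^sub>1 = 1 \<and> n\<^sub>2 = 1 \<and> E = {})"
  shows "int (cubicity (A \<union> B) E) \<le> 2 * (int \<Delta>' + 2) * \<lceil>ln (real n\<^sub>2)\<rceil>"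
proof -
  have fin: "finite A" "finite B" and disj: "A \<inter> B = {}"
    and E: "\<And>e. e \<in> E \<Longrightarrow> \<exists>a\<in>A. \<exists>b\<in>B. e = {a, b}"
    using assms(1) by (auto simp: finite_bipartite_graph_def finite_simple_graph_def)
  show ?thesis
  proof (cases "n\<^sub>2 \<ge> 2")
    case True
    have "cubicity (A \<union> B) E \<le> 2 * (\<Delta>\<^sub>B + 2) * nat \<lceil>ln (real n\<^sub>2)\<rceil>"
      using fin disj True assms E
      by (intro cubicity_bipartite_le) (auto intro: degree_le_max_degree_on)
    moreover have "cubicity (B \<union> A) E \<le> 2 * (\<Delta>\<^sub>A + 2) * nat \<lceil>ln (real n\<^sub>2)\<rceil>"
    proof (rule cubicity_bipartite_le)
      show "\<exists>x\<in>B. \<exists>y\<in>A. e = {x, y}" if "e \<in> E" for e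
        using E[OF that] by (metis insert_commute)
    qed (use fin disj True assms in \<open>auto intro: degree_le_max_degree_on\<close>)
    ultimately have "cubicity (A \<union> B) E \<le> 2 * (\<Delta>' + 2) * nat \<lceil>ln (real n\<^sub>2)\<rceil>"
      using assms(7) by (auto simp: min_def Un_commute)
    then have "int (cubicity (A \<union> B) E) \<le> int (2 * (\<Delta>' + 2) * nat \<lceil>ln (real n\<^sub>2)\<rceil>)"
      by (simp only: of_nat_le_iff)
    moreover have "ln (real n\<^sub>2) > 0" using True by simp
    ultimately show ?thesis by (simp add: algebra_simps)
  next
    case False
    \<comment> \<open>Two distinct vertices force one on each side, and the excluded case then
      supplies the edge. The graph is thus complete and has cubicity 0.\<close>
    have edge: "{u, v} \<in> E" if "u \<in> A \<union> B" "v \<in> A \<union> B" "u \<noteq> v" for u v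
    proof -
      have "card A \<le> 1" "card B \<le> 1" using False assms by auto
      then have *: "\<And>a a'. a \<in> A \<Longrightarrow> a' \<in> A \<Longrightarrow> a = a'" "\<And>b b'. b \<in> B \<Longrightarrow> b' \<in> B \<Longrightarrow> b = b'"
        using fin by (auto simp: card_le_Suc0_iff_eq)
      with that have "A \<noteq> {}" "B \<noteq> {}" by blast+
      then have "card A = 1" "card B = 1"
        using fin \<open>card A \<le> 1\<close> \<open>card B \<le> 1\<close> by (auto simp: card_gt_0_iff le_Suc_eq)
      then obtain e where "e \<in> E" using assms by blast
      then obtain a b where "a \<in> A" "b \<in> B" "{a, b} \<in> E" using E by blast
      then show ?thesis using that * by (metis UnE insert_commute)
    qed
    have "cubicity (A \<union> B) E \<le> 0"
      by (rule cubicity_le[where f = "\<lambda>_ _. 0"]) (use edge in auto)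
    \<comment> \<open>For an empty graph this uses the convention \<open>ln 0 = 0\<close>.\<close>
    moreover have "ln (real n\<^sub>2) = 0" using False by (auto simp: not_le less_Suc_eq numeral_2_eq_2)
    ultimately show ?thesis by simp
  qed
qed

end
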